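(* Let $f\in\mathbb{R}[x,y]$ be a polynomial of degree $n\ge 2$ and let $f_n$ be its homogeneous part of degree $n$. (i) If $f_n$ is elliptic, then there are no umbilic points at infinity of $f$. (ii) If $f_n$ is hyperbolic, then the number of umbilic points at infinity of $f$ is at most twice the number of real linear factors of $f_n$.
   Context: Notation. $f=\sum_{i=0}^n f_i$ with $f_i$ homogeneous of degree $i$; $|\operatorname{Hess} g|=g_{xx}g_{yy}-g_{xy}^2$ is the Hessian function of $g$. A homogeneous polynomial in $\mathbb{R}[x,y]$ is hyperbolic (resp. elliptic) if its Hessian function has no real linear factors and is negative (resp. positive) away from the origin. The form $\Phi$. Let $F(u,v,\omega)=\sum_{i=0}^n\omega^{n-i}f_i(u,v)$ and $A=F_{uv}F_u^2-F_{uu}F_uF_v+\omega^{2(n-1)}F_{uv}$, $B=F_{vv}F_u^2-F_{uu}F_v^2+\omega^{2(n-1)}(F_{vv}-F_{uu})$, $C=F_{vv}F_uF_v-F_{uv}F_v^2-\omega^{2(n-1)}F_{uv}$. The polynomial $u^2A+uvB+v^2C$ is divisible by $\omega$; let $T\in\mathbb{R}[u,v,\omega]$ be defined by $u^2A+uvB+v^2C=\omega T$. On $\mathbb{S}^2=\{u^2+v^2+\omega^2=1\}$ consider the analytic quadratic differential form $$\Phi=\omega A\,du^2+\omega B\,du\,dv+\omega C\,dv^2-(2uA+vB)\,du\,d\omega-(uB+2vC)\,dv\,d\omega+T\,d\omega^2 .$$ It extends to $\mathbb{S}^2$ (via central projection, up to a power of $\omega$) the quadratic form on $\mathbb{R}^2$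 defining the principal directions of the graph of $f$. A flat point of $\Phi$ is a point of $\mathbb{S}^2$ at which all coefficients of $\Phi$ vanish. An umbilic point at infinity (of $f$) is a point of the equator $\mathbb{S}^2\cap\{\omega=0\}$ that is an isolated flat point of $\Phi$. *)

theory Defs
  imports
    "HOL-Analysis.Analysis"
    "HOL-Computational_Algebra.Computational_Algebra"
    "HOL-Computational_Algebra.Field_as_Ring"
begin

text \<open>
  R[x,y] is rendered as \<open>real poly poly\<close> with \<open>y\<close> as the outer variable:
  the coefficient of \<open>x^i y^j\<close> in \<open>f\<close> is \<open>coeff (coeff f j) i\<close>.
  R[u,v,w] is rendered as \<open>real poly poly poly\<close> with \<open>w\<close> (omega) as the outermost
  and \<open>u\<close> as the innermost variable.
\<close>

definition eval2 :: "real poly poly \<Rightarrow> real \<Rightarrow> real \<Rightarrow> real" where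
  "eval2 g x y = poly (poly g [:y:]) x"

definition eval3 :: "real poly poly poly \<Rightarrow> real \<times> real \<times> real \<Rightarrow> real" where
  "eval3 p = (\<lambda>(u, v, w). poly (poly (poly p [:[:w:]:]) [:v:]) u)"

definition dx :: "real poly poly \<Rightarrow> real poly poly" where
  "dx = map_poly pderiv"

definition dy :: "real poly poly \<Rightarrow> real poly poly" where
  "dy = pderiv"

definition du :: "real poly poly poly \<Rightarrow> real poly poly poly" where
  "du = map_poly dx"

definition dv :: "real poly poly poly \<Rightarrow> real poly poly poly" where
  "dv = map_poly dy"

definition var_u :: "real poly poly poly" where "var_u = [:[:[:0, 1:]:]:]"
definition var_v :: "real poly poly poly" where "var_v = [:[:0, 1:]:]"
definition var_w :: "real poly poly poly" where "var_w = [:0, 1:]"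

text \<open>The total degree; the zero polynomial gets degree 0.\<close>

definition total_degree :: "real poly poly \<Rightarrow> nat" where
  "total_degree f = Max (insert 0 {i + j |i j. coeff (coeff f j) i \<noteq> 0})"

definition hom_part :: "nat \<Rightarrow> real poly poly \<Rightarrow> real poly poly" where
  "hom_part m f = (\<Sum>j\<le>m. monom (monom (coeff (coeff f j) (m - j)) (m - j)) j)"

definition Hess :: "real poly poly \<Rightarrow> real poly poly" where
  "Hess g = dx (dx g) * dy (dy g) - (dx (dy g))\<^sup>2"

text \<open>
  The real linear factors of \<open>g\<close> up to nonzero scalars: each class of proportional factors is
  represented by its unique normalized member.  Factors are counted without multiplicity; a
  hyperbolic form of degree at least 2 has no multiple linear factor, as its Hessian would vanish
  along the corresponding line.
\<close>

definition real_linear_factors :: "real poly poly \<Rightarrow> real poly poly set" where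
  "real_linear_factors g = {l. total_degree l = 1 \<and> normalize l = l \<and> l dvd g}"

text \<open>Both notions are meant for (and below only applied to) homogeneous \<open>g\<close>.\<close>

definition hyperbolic :: "real poly poly \<Rightarrow> bool" where
  "hyperbolic g \<longleftrightarrow> real_linear_factors (Hess g) = {} \<and>
     (\<forall>x y. (x, y) \<noteq> (0, 0) \<longrightarrow> eval2 (Hess g) x y < 0)"

definition elliptic :: "real poly poly \<Rightarrow> bool" where
  "elliptic g \<longleftrightarrow> real_linear_factors (Hess g) = {} \<and>
     (\<forall>x y. (x, y) \<noteq> (0, 0) \<longrightarrow> eval2 (Hess g) x y > 0)"

text \<open>The homogenization of \<open>f\<close> in degree \<open>n = total_degree f\<close>.\<close>

definition homogenization :: "real poly poly \<Rightarrow> real poly poly poly" where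
  "homogenization f =
     (\<Sum>i\<le>total_degree f. monom (hom_part i f) (total_degree f - i))"

definition Phi_A :: "real poly poly \<Rightarrow> real poly poly poly" where
  "Phi_A f = (let F = homogenization f; n = total_degree f in
     du (dv F) * (du F)\<^sup>2 - du (du F) * du F * dv F + var_w ^ (2 * (n - 1)) * du (dv F))"

definition Phi_B :: "real poly poly \<Rightarrow> real poly poly poly" where
  "Phi_B f = (let F = homogenization f; n = total_degree f in
     dv (dv F) * (du F)\<^sup>2 - du (du F) * (dv F)\<^sup>2
       + var_w ^ (2 * (n - 1)) * (dv (dv F) - du (du F)))"

definition Phi_C :: "real poly poly \<Rightarrow> real poly poly poly" where
  "Phi_C f = (let F = homogenization f; n = total_degree f in
     dv (dv F) * du F * dv F - du (dv F) * (dv F)\<^sup>2 - var_w ^ (2 * (n - 1)) * du (dv F))"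

text \<open>The quotient is exact when \<open>total_degree f \<ge> 2\<close>; see \<open>Phi_T_exact\<close> below.\<close>

definition Phi_T :: "real poly poly \<Rightarrow> real poly poly poly" where
  "Phi_T f = (var_u\<^sup>2 * Phi_A f + var_u * var_v * Phi_B f + var_v\<^sup>2 * Phi_C f) div var_w"

text \<open>
  A quadratic differential form with polynomial coefficients in the ambient coordinates
  \<open>(u, v, w)\<close>; the field names stand for \<open>du\<^sup>2\<close>, \<open>du dv\<close>, \<open>dv\<^sup>2\<close>, \<open>du dw\<close>, \<open>dv dw\<close>, \<open>dw\<^sup>2\<close>.
\<close>

record quadratic_form =
  coeff_uu :: "real poly poly poly"
  coeff_uv :: "real poly poly poly"
  coeff_vv :: "real poly poly poly"
  coeff_uw :: "real poly poly poly"
  coeff_vw :: "real poly poly poly"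
  coeff_ww :: "real poly poly poly"

definition Phi :: "real poly poly \<Rightarrow> quadratic_form" where
  "Phi f = \<lparr>
     coeff_uu = var_w * Phi_A f,
     coeff_uv = var_w * Phi_B f,
     coeff_vv = var_w * Phi_C f,
     coeff_uw = - (2 * var_u * Phi_A f + var_v * Phi_B f),
     coeff_vw = - (var_u * Phi_B f + 2 * var_v * Phi_C f),
     coeff_ww = Phi_T f\<rparr>"

text \<open>The norm of \<open>real \<times> real \<times> real\<close> is Euclidean, so \<open>sphere 0 1\<close> is the unit sphere.\<close>

definition flat_points :: "quadratic_form \<Rightarrow> (real \<times> real \<times> real) set" where
  "flat_points q = {p \<in> sphere 0 1.
     eval3 (coeff_uu q) p = 0 \<and> eval3 (coeff_uv q) p = 0 \<and> eval3 (coeff_vv q) p = 0 \<and>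
     eval3 (coeff_uw q) p = 0 \<and> eval3 (coeff_vw q) p = 0 \<and> eval3 (coeff_ww q) p = 0}"

definition umbilics_at_infinity :: "real poly poly \<Rightarrow> (real \<times> real \<times> real) set" where
  "umbilics_at_infinity f =
     {(u, v, w) \<in> sphere 0 1. w = 0 \<and> (u, v, w) isolated_in flat_points (Phi f)}"


lemma coeff_dx: "coeff (coeff (dx f) j) i = real (Suc i) * coeff (coeff f j) (Suc i)"
  by (simp add: dx_def coeff_map_poly coeff_pderiv)

lemma coeff_dy: "coeff (coeff (dy f) j) i = real (Suc j) * coeff (coeff f (Suc j)) i"
  by (simp add: dy_def coeff_pderiv of_nat_poly del: of_nat_Suc)

lemma coeff_hom_part:
  "coeff (coeff (hom_part m f) j) i = (if i + j = m then coeff (coeff f j) i else 0)"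
proof -
  have "coeff (coeff (hom_part m f) j) i =
      (\<Sum>k\<le>m. if k = j then if i + j = m then coeff (coeff f j) i else 0 else 0)"
    unfolding hom_part_def coeff_sum by (intro sum.cong) (auto simp: coeff_sum)
  also have "\<dots> = (if i + j = m then coeff (coeff f j) i else 0)"
    by (subst sum.delta) auto
  finally show ?thesis .
qed

lemma dx_dy: "dx (dy g) = dy (dx g)"
  by (intro poly_eqI) (simp add: coeff_dx coeff_dy)

lemma euler:
  assumes "\<And>i j. coeff (coeff g j) i \<noteq> 0 \<Longrightarrow> i + j = m"
  shows "[:[:0, 1:]:] * dx g + [:0, 1:] * dy g = of_nat m * g"
proof (intro poly_eqI)
  fix j i
  have "coeff (coeff ([:[:0, 1:]:] * dx g + [:0, 1:] * dy g) j) i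
      = real (i + j) * coeff (coeff g j) i"
    by (cases i; cases j) (auto simp: coeff_dx coeff_dy coeff_pCons algebra_simps)
  also have "\<dots> = coeff (coeff (of_nat m * g) j) i"
    using assms[of j i] by (cases "coeff (coeff g j) i = 0") (auto simp: of_nat_poly)
  finally show "coeff (coeff ([:[:0, 1:]:] * dx g + [:0, 1:] * dy g) j) i
      = coeff (coeff (of_nat m * g) j) i" .
qed

lemma coeff_du: "coeff (du F) k = dx (coeff F k)"
  by (simp add: du_def coeff_map_poly dx_def)

lemma coeff_dv: "coeff (dv F) k = dy (coeff F k)"
  by (simp add: dv_def coeff_map_poly dy_def)

lemma coeff_homogenization_0: "coeff (homogenization f) 0 = hom_part (total_degree f) f"
proof -
  have "coeff (homogenization f) 0 =
      (\<Sum>i\<le>total_degree f. if i = total_degree f then hom_part i f else 0)"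
    unfolding homogenization_def coeff_sum by (intro sum.cong) auto
  thus ?thesis by simp
qed

lemma Phi_T_exact:
  assumes "total_degree f \<ge> 2"
  shows "var_u\<^sup>2 * Phi_A f + var_u * var_v * Phi_B f + var_v\<^sup>2 * Phi_C f = var_w * Phi_T f"
proof -
  define n where "n = total_degree f"
  define G where "G = hom_part n f"
  define x y :: "real poly poly" where "x = [:[:0, 1:]:]" and "y = [:0, 1:]"
  let ?S = "var_u\<^sup>2 * Phi_A f + var_u * var_v * Phi_B f + var_v\<^sup>2 * Phi_C f"
  have hom: "coeff (coeff G j) i \<noteq> 0 \<Longrightarrow> i + j = n" for i j
    by (auto simp: G_def coeff_hom_part split: if_splits)
  have e1: "x * dx (dx G) + y * dx (dy G) = of_nat (n - 1) * dx G"
    unfolding x_def y_def dx_dy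
    by (rule euler) (use hom in \<open>fastforce simp: coeff_dx\<close>)
  have e2: "x * dx (dy G) + y * dy (dy G) = of_nat (n - 1) * dy G"
    unfolding x_def y_def
    by (rule euler) (use hom in \<open>fastforce simp: coeff_dy\<close>)
  have c: "coeff var_u 0 = x" "coeff var_v 0 = y" "coeff (homogenization f) 0 = G"
    by (simp_all add: var_u_def var_v_def x_def y_def G_def n_def coeff_homogenization_0)
  have w: "coeff var_w 0 ^ (2 * (total_degree f - 1)) = 0"
    using assms by (simp add: var_w_def)
  have "coeff ?S 0 =
      x\<^sup>2 * (dx (dy G) * (dx G)\<^sup>2 - dx (dx G) * dx G * dy G)
      + x * y * (dy (dy G) * (dx G)\<^sup>2 - dx (dx G) * (dy G)\<^sup>2)
      + y\<^sup>2 * (dy (dy G) * dx G * dy G - dx (dy G) * (dy G)\<^sup>2)"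
    unfolding Phi_A_def Phi_B_def Phi_C_def Let_def
    by (simp only: coeff_add coeff_diff coeff_mult_0 coeff_0_power coeff_du coeff_dv w c
        mult_zero_left add_0_right diff_0_right mult.assoc)
  also have "\<dots> = (x * dx G + y * dy G) *
      ((x * dx (dy G) + y * dy (dy G)) * dx G - (x * dx (dx G) + y * dx (dy G)) * dy G)"
    by (simp add: algebra_simps power2_eq_square)
  also have "\<dots> = 0"
    unfolding e1 e2 by (simp add: algebra_simps)
  finally have "coeff ?S 0 = 0" .
  hence "var_w dvd ?S"
    by (simp add: var_w_def dvd_iff_poly_eq_0 poly_0_coeff_0)
  thus ?thesis unfolding Phi_T_def by simp
qed

end

theory Submission
  imports Defs
begin

text \<open>
  Put \<open>G = f\<^sub>n\<close>.  At a point \<open>(u, v, 0)\<close> only \<open>G\<close> enters the coefficients \<open>A\<close>, \<open>B\<close>, \<open>C\<close>,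
  and Euler's relations for \<open>G\<close> and its first derivatives turn the two mixed coefficients \<open>2uA + vB\<close> and \<open>uB + 2vC\<close> into \<open>-v\<close> and \<open>u\<close> times the same
  multiple of \<open>G \<cdot> Hess G\<close> (lemma \<open>mixed_coefficients_by_euler\<close>).  As \<open>(u, v) \<noteq> (0, 0)\<close>, a flat
  point at infinity at which the Hessian does not vanish is a zero of \<open>G\<close> on the unit circle
  (lemma \<open>leading_form_zero_at_infinite_flat_point\<close>).

  If \<open>G\<close> is elliptic, its second derivative at \<open>(u, v) \<noteq> (0, 0)\<close> is a definite quadratic form,
  whose value at \<open>(u, v)\<close> itself is \<open>n (n - 1) G(u, v)\<close>; so \<open>G\<close> has no zeros and there is no flat
  point at infinity at all.  If \<open>G\<close> is hyperbolic, then \<open>G \<noteq> 0\<close>, every zero of \<open>G\<close> on the circle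
  lies on the line of a real linear factor of \<open>G\<close>, and each line meets the circle in two points
  (lemma \<open>card_zeros_on_circle\<close>).
\<close>

section \<open>Evaluation of polynomials\<close>

lemma eval2_0 [simp]: "eval2 0 x y = 0"
  by (simp add: eval2_def)

lemma eval2_add [simp]: "eval2 (p + q) x y = eval2 p x y + eval2 q x y"
  by (simp add: eval2_def)

lemma eval2_diff [simp]: "eval2 (p - q) x y = eval2 p x y - eval2 q x y"
  by (simp add: eval2_def)

lemma eval2_mult [simp]: "eval2 (p * q) x y = eval2 p x y * eval2 q x y"
  by (simp add: eval2_def)

lemma eval2_power [simp]: "eval2 (p ^ k) x y = eval2 p x y ^ k"
  by (simp add: eval2_def)

lemma eval2_of_nat [simp]: "eval2 (of_nat k) x y = of_nat k"
  by (simp add: eval2_def of_nat_poly)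

lemma eval3_add [simp]: "eval3 (p + q) z = eval3 p z + eval3 q z"
  by (simp add: eval3_def split: prod.split)

lemma eval3_diff [simp]: "eval3 (p - q) z = eval3 p z - eval3 q z"
  by (simp add: eval3_def split: prod.split)

lemma eval3_minus [simp]: "eval3 (- p) z = - eval3 p z"
  by (simp add: eval3_def split: prod.split)

lemma eval3_mult [simp]: "eval3 (p * q) z = eval3 p z * eval3 q z"
  by (simp add: eval3_def split: prod.split)

lemma eval3_numeral [simp]: "eval3 (numeral k) z = numeral k"
  by (simp add: eval3_def numeral_poly split: prod.split)

lemma eval3_var_u [simp]: "eval3 var_u (u, v, w) = u"
  by (simp add: eval3_def var_u_def)

lemma eval3_var_v [simp]: "eval3 var_v (u, v, w) = v"
  by (simp add: eval3_def var_v_def)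

lemma eval3_at_infinity: "eval3 p (u, v, 0) = eval2 (coeff p 0) u v"
  by (simp add: eval3_def eval2_def poly_0_coeff_0)

lemma eval2_hom_part:
  "eval2 (hom_part m g) x y = (\<Sum>j\<le>m. coeff (coeff g j) (m - j) * x ^ (m - j) * y ^ j)"
  by (simp add: eval2_def hom_part_def poly_sum poly_monom poly_power)

lemma eval2_hom_part_scale:
  "eval2 (hom_part m g) (s * x) (s * y) = s ^ m * eval2 (hom_part m g) x y"
  unfolding eval2_hom_part sum_distrib_left
proof (rule sum.cong)
  fix j assume "j \<in> {..m}"
  hence "s ^ m = s ^ (m - j) * s ^ j"
    by (simp flip: power_add)
  thus "coeff (coeff g j) (m - j) * (s * x) ^ (m - j) * (s * y) ^ j =
      s ^ m * (coeff (coeff g j) (m - j) * x ^ (m - j) * y ^ j)"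
    by (simp add: power_mult_distrib)
qed simp

section \<open>Euler's relations and the Hessian\<close>

lemma eval2_euler:
  assumes "\<And>i j. coeff (coeff g j) i \<noteq> 0 \<Longrightarrow> i + j = m"
  shows "x * eval2 (dx g) x y + y * eval2 (dy g) x y = real m * eval2 g x y"
proof -
  have "[:[:0, 1:]:] * dx g + [:0, 1:] * dy g = of_nat m * g"
    by (rule euler) (rule assms)
  hence "eval2 ([:[:0, 1:]:] * dx g + [:0, 1:] * dy g) x y = eval2 (of_nat m * g) x y"
    by (simp only:)
  moreover have "eval2 [:[:0, 1:]:] x y = x" "eval2 [:0, 1:] x y = y"
    by (simp_all add: eval2_def)
  ultimately show ?thesis
    by (simp only: eval2_add eval2_mult eval2_of_nat)
qed

lemma eval2_euler_hom_part:
  fixes m :: nat and g :: "real poly poly"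
  defines "G \<equiv> hom_part m g"
  shows "x * eval2 (dx G) x y + y * eval2 (dy G) x y = real m * eval2 G x y"
    and "x * eval2 (dx (dx G)) x y + y * eval2 (dx (dy G)) x y = real (m - 1) * eval2 (dx G) x y"
    and "x * eval2 (dx (dy G)) x y + y * eval2 (dy (dy G)) x y = real (m - 1) * eval2 (dy G) x y"
proof -
  have hom: "coeff (coeff G j) i \<noteq> 0 \<Longrightarrow> i + j = m" for i j
    by (auto simp: G_def coeff_hom_part split: if_splits)
  show "x * eval2 (dx G) x y + y * eval2 (dy G) x y = real m * eval2 G x y"
    by (rule eval2_euler) (rule hom)
  show "x * eval2 (dx (dx G)) x y + y * eval2 (dx (dy G)) x y = real (m - 1) * eval2 (dx G) x y"
    unfolding dx_dy by (rule eval2_euler) (use hom in \<open>fastforce simp: coeff_dx\<close>)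
  show "x * eval2 (dx (dy G)) x y + y * eval2 (dy (dy G)) x y = real (m - 1) * eval2 (dy G) x y"
    by (rule eval2_euler) (use hom in \<open>fastforce simp: coeff_dy\<close>)
qed

text \<open>
  The second-order Euler relations say that the Hessian matrix maps \<open>(u, v)\<close> to \<open>N\<close> times the
  gradient, so by Cramer's rule \<open>N (s p - r q) = - v (r t - s\<^sup>2)\<close> and \<open>N (t p - s q) = u (r t - s\<^sup>2)\<close>.
  Each mixed coefficient is a combination of these two determinants in which \<open>u p + v q\<close> factors out.
\<close>

lemma mixed_coefficients_by_euler:
  fixes u v p q r s t g N m :: real
  assumes grad: "u * p + v * q = m * g"
    and hess_u: "u * r + v * s = N * p" and hess_v: "u * s + v * t = N * q"
  defines "A \<equiv> s * p\<^sup>2 - r * p * q" and "B \<equiv> t * p\<^sup>2 - r * q\<^sup>2" and "C \<equiv> t * p * q - s * q\<^sup>2"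
  shows "N * (2 * u * A + v * B) = - v * m * g * (r * t - s\<^sup>2)"
    and "N * (u * B + 2 * v * C) = u * m * g * (r * t - s\<^sup>2)"
proof -
  have 1: "N * (s * p - r * q) = - v * (r * t - s\<^sup>2)"
    using hess_u hess_v by algebra
  have 2: "N * (t * p - s * q) = u * (r * t - s\<^sup>2)"
    using hess_u hess_v by algebra
  have A: "A = p * (s * p - r * q)" and B: "B = p * (t * p - s * q) + q * (s * p - r * q)"
    and C: "C = q * (t * p - s * q)"
    by (simp_all add: A_def B_def C_def algebra_simps power2_eq_square)
  have "N * (2 * u * A + v * B) =
      (2 * u * p + v * q) * (N * (s * p - r * q)) + v * p * (N * (t * p - s * q))"
    unfolding A B by (simp add: algebra_simps)
  also have "\<dots> = - v * (u * p + v * q) * (r * t - s\<^sup>2)"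
    unfolding 1 2 by (simp add: algebra_simps)
  finally show "N * (2 * u * A + v * B) = - v * m * g * (r * t - s\<^sup>2)"
    by (simp add: grad)
  have "N * (u * B + 2 * v * C) =
      (u * p + 2 * v * q) * (N * (t * p - s * q)) + u * q * (N * (s * p - r * q))"
    unfolding B C by (simp add: algebra_simps)
  also have "\<dots> = u * (u * p + v * q) * (r * t - s\<^sup>2)"
    unfolding 1 2 by (simp add: algebra_simps)
  finally show "N * (u * B + 2 * v * C) = u * m * g * (r * t - s\<^sup>2)"
    by (simp add: grad)
qed

text \<open>Completing the square: \<open>r\<close> times the form is \<open>(r u + s v)\<^sup>2 + (r t - s\<^sup>2) v\<^sup>2\<close>.\<close>

lemma definite_quadratic_form_zero:
  fixes r s t u v :: real
  assumes "r * t - s\<^sup>2 > 0" and zero: "u\<^sup>2 * r + 2 * u * v * s + v\<^sup>2 * t = 0"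
  shows "u = 0 \<and> v = 0"
proof -
  have "(r * u + s * v)\<^sup>2 + (r * t - s\<^sup>2) * v\<^sup>2 = r * (u\<^sup>2 * r + 2 * u * v * s + v\<^sup>2 * t)"
    by (simp add: algebra_simps power2_eq_square)
  hence sum: "(r * u + s * v)\<^sup>2 + (r * t - s\<^sup>2) * v\<^sup>2 = 0"
    by (simp only: zero mult_zero_right)
  moreover have "(r * t - s\<^sup>2) * v\<^sup>2 \<ge> 0"
    using assms(1) by simp
  ultimately have "(r * t - s\<^sup>2) * v\<^sup>2 = 0"
    using zero_le_power2[of "r * u + s * v"] by linarith
  hence "v = 0"
    using assms(1) by simp
  moreover have "r \<noteq> 0"
    using assms(1) by auto
  ultimately show ?thesis
    using zero by simp
qed

lemma elliptic_form_no_zeros: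
  assumes "elliptic (hom_part n f)" and "(u, v) \<noteq> (0, 0)"
  shows "eval2 (hom_part n f) u v \<noteq> 0"
proof
  define G where "G = hom_part n f"
  assume "eval2 (hom_part n f) u v = 0"
  hence zero: "eval2 G u v = 0"
    by (simp add: G_def)
  note e = eval2_euler_hom_part[of u n f v, folded G_def]
  let ?r = "eval2 (dx (dx G)) u v" and ?s = "eval2 (dx (dy G)) u v" and ?t = "eval2 (dy (dy G)) u v"
  have "u\<^sup>2 * ?r + 2 * u * v * ?s + v\<^sup>2 * ?t = u * (u * ?r + v * ?s) + v * (u * ?s + v * ?t)"
    by (simp add: algebra_simps power2_eq_square)
  also have "\<dots> = real (n - 1) * (u * eval2 (dx G) u v + v * eval2 (dy G) u v)"
    unfolding e(2,3) by (simp add: algebra_simps)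
  also have "\<dots> = 0"
    unfolding e(1) zero by simp
  finally have "u\<^sup>2 * ?r + 2 * u * v * ?s + v\<^sup>2 * ?t = 0" .
  moreover have "?r * ?t - ?s\<^sup>2 > 0"
    using assms by (simp add: elliptic_def Hess_def G_def)
  ultimately show False
    using definite_quadratic_form_zero assms(2) by blast
qed

section \<open>Flat points at infinity\<close>

lemma eval3_Phi_at_infinity:
  fixes u v :: real
  assumes "total_degree f = n" and "n \<ge> 2"
  defines "G \<equiv> hom_part n f"
  defines "p \<equiv> eval2 (dx G) u v" and "q \<equiv> eval2 (dy G) u v"
  defines "r \<equiv> eval2 (dx (dx G)) u v" and "s \<equiv> eval2 (dx (dy G)) u v"
    and "t \<equiv> eval2 (dy (dy G)) u v"
  shows "eval3 (Phi_A f) (u, v, 0) = s * p\<^sup>2 - r * p * q"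
    and "eval3 (Phi_B f) (u, v, 0) = t * p\<^sup>2 - r * q\<^sup>2"
    and "eval3 (Phi_C f) (u, v, 0) = t * p * q - s * q\<^sup>2"
proof -
  have w: "coeff var_w 0 ^ (2 * (n - 1)) = 0"
    using assms(2) by (simp add: var_w_def)
  note coeffs = coeff_add coeff_diff coeff_mult_0 coeff_0_power coeff_du coeff_dv w
    coeff_homogenization_0 assms(1)
  show "eval3 (Phi_A f) (u, v, 0) = s * p\<^sup>2 - r * p * q"
    unfolding eval3_at_infinity Phi_A_def Let_def coeffs by (simp add: assms)
  show "eval3 (Phi_B f) (u, v, 0) = t * p\<^sup>2 - r * q\<^sup>2"
    unfolding eval3_at_infinity Phi_B_def Let_def coeffs by (simp add: assms)
  show "eval3 (Phi_C f) (u, v, 0) = t * p * q - s * q\<^sup>2"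
    unfolding eval3_at_infinity Phi_C_def Let_def coeffs by (simp add: assms)
qed

text \<open>
  The coefficients of \<open>du\<^sup>2\<close>, \<open>du dv\<close> and \<open>dv\<^sup>2\<close> carry the factor \<open>\<omega>\<close> and vanish on the whole equator;
  the constraint on \<open>(u, v)\<close> comes from the coefficients of \<open>du d\<omega>\<close> and \<open>dv d\<omega>\<close>, which are \<open>v\<close> and
  \<open>u\<close> times one common factor, up to sign.
\<close>

lemma leading_form_zero_at_infinite_flat_point:
  assumes n: "total_degree f = n" "n \<ge> 2"
    and flat: "(u, v, 0) \<in> flat_points (Phi f)"
    and Hess: "eval2 (Hess (hom_part n f)) u v \<noteq> 0"
  shows "u\<^sup>2 + v\<^sup>2 = 1 \<and> eval2 (hom_part n f) u v = 0"
proof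
  have "norm (u, v, 0 :: real) = 1"
    using flat by (simp add: flat_points_def)
  thus circle: "u\<^sup>2 + v\<^sup>2 = 1"
    by (simp add: norm_Pair)
  have "eval3 (coeff_uw (Phi f)) (u, v, 0) = 0" and "eval3 (coeff_vw (Phi f)) (u, v, 0) = 0"
    using flat by (simp_all add: flat_points_def)
  hence uw: "2 * u * eval3 (Phi_A f) (u, v, 0) + v * eval3 (Phi_B f) (u, v, 0) = 0"
    and vw: "u * eval3 (Phi_B f) (u, v, 0) + 2 * v * eval3 (Phi_C f) (u, v, 0) = 0"
    unfolding Phi_def by simp_all
  note mixed = mixed_coefficients_by_euler[OF eval2_euler_hom_part[of u n f v]]
  let ?H = "eval2 (dx (dx (hom_part n f))) u v * eval2 (dy (dy (hom_part n f))) u v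
    - (eval2 (dx (dy (hom_part n f))) u v)\<^sup>2"
  let ?G = "eval2 (hom_part n f) u v"
  have "v * real n * ?G * ?H = 0" and "u * real n * ?G * ?H = 0"
    using mixed uw vw unfolding eval3_Phi_at_infinity[OF n] by simp_all
  moreover have "?H \<noteq> 0"
    using Hess by (simp add: Hess_def)
  moreover have "u \<noteq> 0 \<or> v \<noteq> 0"
    using circle by auto
  ultimately show "?G = 0"
    using n(2) by auto
qed

section \<open>Zeros on the circle and linear factors\<close>

text \<open>
  The normalized linear form vanishing at \<open>(a, b)\<close>: normalization scales the coefficient of the
  outer variable \<open>y\<close> to 1, or that of \<open>x\<close> if \<open>y\<close> is absent.
\<close>

definition line_through :: "real \<Rightarrow> real \<Rightarrow> real poly poly" where
  "line_through a b = (if a = 0 then [:[:0, 1:]:] else [:[:0, - (b / a):], 1:])"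

lemma total_degree_line_through: "total_degree (line_through a b) = 1"
proof -
  have deg: "total_degree g = 1"
    if "\<And>i j. coeff (coeff g j) i \<noteq> 0 \<Longrightarrow> i + j = 1" and "coeff (coeff g j) i \<noteq> 0" for g i j
  proof -
    have "{i + j |i j. coeff (coeff g j) i \<noteq> 0} = {1}"
    proof
      show "{i + j |i j. coeff (coeff g j) i \<noteq> 0} \<subseteq> {1}"
        using that(1) by blast
      have "i + j = 1"
        using that by blast
      thus "{1} \<subseteq> {i + j |i j. coeff (coeff g j) i \<noteq> 0}"
        using that(2) by force
    qed
    thus ?thesis
      by (simp add: total_degree_def)
  qed
  show ?thesis
  proof (cases "a = 0")
    case True
    show ?thesis
      by (rule deg[where i = 1 and j = 0])
        (auto simp: line_through_def True coeff_pCons split: nat.splits)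
  next
    case False
    show ?thesis
      by (rule deg[where i = 0 and j = 1])
        (auto simp: line_through_def False coeff_pCons split: nat.splits)
  qed
qed

lemma normalize_line_through: "normalize (line_through a b) = line_through a b"
  by (simp add: line_through_def normalize_poly_def unit_factor_poly_def flip: one_pCons)

text \<open>
  Divisibility by \<open>y - (b / a) x\<close> means that substituting \<open>y = (b / a) x\<close> gives the zero polynomial
  in \<open>x\<close>; by homogeneity its values are multiples of the value at \<open>(a, b)\<close>.  On the line \<open>x = 0\<close>
  only the monomial \<open>y\<^sup>n\<close> contributes to the value at \<open>(0, b)\<close>, so its coefficient vanishes.
\<close>

lemma line_through_dvd:
  assumes zero: "eval2 (hom_part n f) a b = 0" and "(a, b) \<noteq> (0, 0)"
  shows "line_through a b dvd hom_part n f"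
proof (cases "a = 0")
  case True
  hence "b \<noteq> 0"
    using assms(2) by simp
  have "eval2 (hom_part n f) 0 b = (\<Sum>j\<le>n. if j = n then coeff (coeff f n) 0 * b ^ n else 0)"
    unfolding eval2_hom_part by (intro sum.cong) auto
  hence "coeff (coeff f n) 0 = 0"
    using zero True \<open>b \<noteq> 0\<close> by simp
  hence "coeff (coeff (hom_part n f) j) 0 = 0" for j
    by (simp add: coeff_hom_part)
  hence "[:0, 1:] dvd coeff (hom_part n f) j" for j
    using poly_eq_0_iff_dvd[of "coeff (hom_part n f) j" 0] by (simp add: poly_0_coeff_0)
  thus ?thesis
    by (simp add: line_through_def True const_poly_dvd_iff)
next
  case False
  have "poly (poly (hom_part n f) [:0, b / a:]) x = 0" for x
  proof -
    have "poly (poly (hom_part n f) [:0, b / a:]) x = poly (poly (hom_part n f) [:x * (b / a):]) x"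
      by (simp add: hom_part_def poly_sum poly_monom poly_power)
    also have "\<dots> = eval2 (hom_part n f) (x / a * a) (x / a * b)"
      using False by (simp add: eval2_def)
    also have "\<dots> = 0"
      unfolding eval2_hom_part_scale zero by simp
    finally show ?thesis .
  qed
  hence "poly (hom_part n f) [:0, b / a:] = 0"
    by (simp flip: poly_all_0_iff_0)
  thus ?thesis
    by (simp add: poly_eq_0_iff_dvd line_through_def False)
qed

lemma line_through_eq_imp_antipodal:
  assumes "line_through a b = line_through c d" and "a\<^sup>2 + b\<^sup>2 = 1" and "c\<^sup>2 + d\<^sup>2 = 1"
  shows "(a, b) = (c, d) \<or> (a, b) = (- c, - d)"
proof (cases "a = 0")
  case True
  hence "c = 0"
    using assms(1) by (simp add: line_through_def split: if_splits)
  thus ?thesis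
    using True assms(2,3) by (auto simp: power2_eq_1_iff)
next
  case False
  hence c: "c \<noteq> 0" and slope: "b / a = d / c"
    using assms(1) by (auto simp: line_through_def split: if_splits)
  define k where "k = d / c"
  have b: "b = k * a" and d: "d = k * c"
    using False c slope by (simp_all add: k_def field_simps)
  have "a\<^sup>2 * (1 + k\<^sup>2) = c\<^sup>2 * (1 + k\<^sup>2)"
    using assms(2,3) unfolding b d by (simp add: algebra_simps power_mult_distrib)
  moreover have "1 + k\<^sup>2 \<noteq> 0"
    using zero_le_power2[of k] by linarith
  ultimately have "a = c \<or> a = - c"
    by (simp add: power2_eq_iff)
  thus ?thesis
    unfolding b d by auto
qed

lemma finite_submultisets: "finite {M. M \<subseteq># N}"
proof (induction N)
  case empty
  show ?case
    by simp
next
  case (add x N)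
  have "{M. M \<subseteq># add_mset x N} \<subseteq> {M. M \<subseteq># N} \<union> add_mset x ` {M. M \<subseteq># N}"
  proof
    fix M assume "M \<in> {M. M \<subseteq># add_mset x N}"
    hence M: "M \<subseteq># add_mset x N"
      by simp
    show "M \<in> {M. M \<subseteq># N} \<union> add_mset x ` {M. M \<subseteq># N}"
    proof (cases "x \<in># M")
      case True
      then obtain M' where "M = add_mset x M'"
        by (metis insert_DiffM)
      thus ?thesis
        using M by auto
    next
      case False
      have "M \<subseteq># N"
      proof (rule mset_subset_eqI)
        fix y
        show "count M y \<le> count N y"
          using mset_subset_eq_count[OF M, of y] False by (cases "y = x") (simp_all add: not_in_iff)
      qed
      thus ?thesis
        by simp
    qed
  qed
  thus ?case
    using add.IH by (meson finite_UnI finite_imageI finite_subset)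
qed

text \<open>A normalized divisor of \<open>g\<close> is determined by its prime factorization, a submultiset of that of \<open>g\<close>.\<close>

lemma finite_real_linear_factors:
  assumes "g \<noteq> 0"
  shows "finite (real_linear_factors g)"
proof (rule finite_subset)
  let ?P = "prime_factorization g"
  show "real_linear_factors g \<subseteq> (\<lambda>M. normalize (prod_mset M)) ` {M. M \<subseteq># ?P}"
  proof
    fix l assume "l \<in> real_linear_factors g"
    hence l: "normalize l = l" "l dvd g"
      by (auto simp: real_linear_factors_def)
    with assms have "l \<noteq> 0"
      by auto
    hence "l = normalize (prod_mset (prime_factorization l))"
      using l by (simp add: prod_mset_prime_factorization_weak)
    moreover have "prime_factorization l \<subseteq># ?P"
      using l assms \<open>l \<noteq> 0\<close> by (simp add: prime_factorization_subset_iff_dvd)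
    ultimately show "l \<in> (\<lambda>M. normalize (prod_mset M)) ` {M. M \<subseteq># ?P}"
      by blast
  qed
  show "finite ((\<lambda>M. normalize (prod_mset M)) ` {M. M \<subseteq># ?P})"
    by (intro finite_imageI finite_submultisets)
qed

lemma card_le_mult_card_image:
  assumes "finite (h ` S)" and "\<And>y. y \<in> h ` S \<Longrightarrow> finite {x \<in> S. h x = y} \<and> card {x \<in> S. h x = y} \<le> k"
  shows "finite S \<and> card S \<le> k * card (h ` S)"
proof -
  have S: "(\<Union>y\<in>h ` S. {x \<in> S. h x = y}) = S"
    by blast
  have "finite (\<Union>y\<in>h ` S. {x \<in> S. h x = y})"
    using assms by (intro finite_UN_I) auto
  hence "finite S"
    unfolding S .
  moreover have "card S \<le> (\<Sum>y\<in>h ` S. card {x \<in> S. h x = y})"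
    using card_UN_le[OF assms(1), of "\<lambda>y. {x \<in> S. h x = y}"] unfolding S .
  moreover have "\<dots> \<le> (\<Sum>y\<in>h ` S. k)"
    using assms(2) by (intro sum_mono) auto
  ultimately show ?thesis
    by (simp add: mult.commute)
qed

text \<open>
  Each zero is sent to the normalized linear form vanishing there, which divides the form;
  two points of the circle with the same image are equal or antipodal.
\<close>

lemma card_zeros_on_circle:
  assumes "hom_part n f \<noteq> 0"
  defines "Z \<equiv> {(u, v). u\<^sup>2 + v\<^sup>2 = 1 \<and> eval2 (hom_part n f) u v = 0}"
  shows "finite Z \<and> card Z \<le> 2 * card (real_linear_factors (hom_part n f))"
proof -
  let ?h = "\<lambda>(a, b). line_through a b"
  have sub: "?h ` Z \<subseteq> real_linear_factors (hom_part n f)"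
    by (auto simp: Z_def real_linear_factors_def total_degree_line_through
        normalize_line_through intro!: line_through_dvd)
  note fin = finite_real_linear_factors[OF assms(1)]
  have "finite Z \<and> card Z \<le> 2 * card (?h ` Z)"
  proof (rule card_le_mult_card_image)
    show "finite (?h ` Z)"
      using sub fin by (rule finite_subset)
    fix l assume "l \<in> ?h ` Z"
    then obtain c d where cd: "(c, d) \<in> Z" "l = line_through c d"
      by auto
    have "{z \<in> Z. ?h z = l} \<subseteq> {(c, d), (- c, - d)}"
      using cd line_through_eq_imp_antipodal by (fastforce simp: Z_def)
    moreover have "card {(c, d), (- c, - d)} \<le> 2"
      by (simp add: card_insert_if)
    ultimately show "finite {z \<in> Z. ?h z = l} \<and> card {z \<in> Z. ?h z = l} \<le> 2"
      by (meson card_mono finite.emptyI finite.insertI finite_subset le_trans)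
  qed
  moreover have "card (?h ` Z) \<le> card (real_linear_factors (hom_part n f))"
    using card_mono[OF fin sub] .
  ultimately show ?thesis
    by linarith
qed

section \<open>Umbilic points at infinity\<close>

theorem corollary4p8:
  fixes f :: "real poly poly" and n :: nat
  assumes "total_degree f = n" and "n \<ge> 2"
  shows "(elliptic (hom_part n f) \<longrightarrow> umbilics_at_infinity f = {}) \<and>
         (hyperbolic (hom_part n f) \<longrightarrow>
            finite (umbilics_at_infinity f) \<and>
            card (umbilics_at_infinity f) \<le> 2 * card (real_linear_factors (hom_part n f)))"
proof (intro conjI impI)
  let ?G = "hom_part n f"
  let ?Z = "{(u, v). u\<^sup>2 + v\<^sup>2 = 1 \<and> eval2 ?G u v = 0}"
  have sub: "umbilics_at_infinity f \<subseteq> (\<lambda>(u, v). (u, v, 0)) ` ?Z"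
    if Hess: "\<And>u v. (u, v) \<noteq> (0, 0) \<Longrightarrow> eval2 (Hess ?G) u v \<noteq> 0"
  proof
    fix z assume "z \<in> umbilics_at_infinity f"
    then obtain u v where z: "z = (u, v, 0)" and flat: "(u, v, 0) \<in> flat_points (Phi f)"
      by (auto simp: umbilics_at_infinity_def isolated_in_def)
    have "(u, v) \<noteq> (0, 0)"
      using flat by (auto simp: flat_points_def norm_Pair)
    hence "(u, v) \<in> ?Z"
      using leading_form_zero_at_infinite_flat_point[OF assms flat Hess] by simp
    thus "z \<in> (\<lambda>(u, v). (u, v, 0)) ` ?Z"
      unfolding z by force
  qed
  {
    assume ell: "elliptic ?G"
    have "umbilics_at_infinity f \<subseteq> (\<lambda>(u, v). (u, v, 0)) ` ?Z"
    proof (rule sub)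
      fix u v :: real assume "(u, v) \<noteq> (0, 0)"
      hence "eval2 (Hess ?G) u v > 0"
        using ell unfolding elliptic_def by blast
      thus "eval2 (Hess ?G) u v \<noteq> 0"
        by simp
    qed
    moreover have "?Z = {}"
    proof -
      have "eval2 ?G u v \<noteq> 0" if "u\<^sup>2 + v\<^sup>2 = 1" for u v
        using that by (intro elliptic_form_no_zeros[OF ell]) auto
      thus ?thesis
        by blast
    qed
    ultimately show "umbilics_at_infinity f = {}"
      by simp
  }
  assume hyp: "hyperbolic ?G"
  have neg: "eval2 (Hess ?G) u v < 0" if "(u, v) \<noteq> (0, 0)" for u v
    using hyp that unfolding hyperbolic_def by blast
  have U: "umbilics_at_infinity f \<subseteq> (\<lambda>(u, v). (u, v, 0)) ` ?Z"
    by (rule sub) (metis neg less_irrefl)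
  have "Hess ?G \<noteq> 0"
    using neg[of 1 0] by auto
  hence "?G \<noteq> 0"
    by (auto simp: Hess_def dx_def dy_def)
  hence fin: "finite ?Z" and card: "card ?Z \<le> 2 * card (real_linear_factors ?G)"
    using card_zeros_on_circle by blast+
  show "finite (umbilics_at_infinity f)"
    using U finite_imageI[OF fin] by (rule finite_subset)
  have "card (umbilics_at_infinity f) \<le> card ((\<lambda>(u, v). (u, v, 0 :: real)) ` ?Z)"
    using finite_imageI[OF fin] U by (rule card_mono)
  also have "\<dots> \<le> card ?Z"
    using fin by (rule card_image_le)
  also note card
  finally show "card (umbilics_at_infinity f) \<le> 2 * card (real_linear_factors ?G)" .
qed

end
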